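(* Let $n\ge1$ and let $\mathbf k=(k_1,\dots,k_n)\in\mathbb Z^n$ with $k_1\ge\cdots\ge k_n\ge 0$. With the $\Omega\times\Omega$ matrices $A_w,B_w,C_w,X_w,Y_w,R_w,S_w$ ($w\ge0$ an integer) defined in the context, put $$M=\begin{pmatrix} B_0 & C_0 & 0 & \\ {A_1} & B_1 & C_1 & 0 \\ 0 & A_2 & B_2 & C_2 & \ddots \\ & & \ddots & \ddots & \ddots \end{pmatrix},\quad M_1=\begin{pmatrix} Y_0 & X_0 & 0 & \\ 0 & Y_1 & X_1 & 0 \\ & 0 & Y_2 & X_2 & \ddots \\ & & & \ddots & \ddots \end{pmatrix},\quad M_2=\begin{pmatrix} S_0 & 0 & & \\ {R_1} & S_1 & 0 & \\ 0 & R_2 & S_2 & \ddots \\ & & \ddots & \ddots \end{pmatrix}.$$ Then $$A_w=Y_wR_w,\qquad B_w=X_wR_{w+1}+Y_wS_w,\qquad C_w=X_wS_{w+1},$$ which is equivalent to the factorization $M=M_1M_2$. Moreover both factors $M_1$ and $M_2$ are stochastic matrices (all entries are nonnegative and the entries of each row sum to $1$).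
   Context: For integer tuples $\mathbf m=(m_1,\dots,m_{n+1})$ and $1\le i\le n+1$ (with $\mathbf k$ fixed) put $$a_i^2(\mathbf m)=\left\vert\frac{\prod_{j=1}^{n}(k_j-m_i-j+i-1)}{\prod_{j\ne i}(m_j-m_i-j+i)}\right\vert,\qquad b_i^2(\mathbf m)=\left\vert\frac{\prod_{j=1}^{n}(k_j-m_i-j+i)}{\prod_{j\ne i}(m_j-m_i-j+i)}\right\vert,$$ where in the denominators $j$ ranges over $\{1,\dots,n+1\}\setminus\{i\}$. $\Omega=\{\mathbf r=(r_1,\dots,r_{n-1})\in\mathbb Z^{n-1}: 0\le r_i\le k_i-k_{i+1}\}$ (a single point if $n=1$). For an integer $w\ge0$ and $\mathbf r\in\Omega$ let $$\mathbf m(w,\mathbf r)=(w+k_1,\;r_1+k_2,\;\dots,\;r_{n-1}+k_n,\;-(w+r_1+\cdots+r_{n-1})).$$ $\mathbf e_i$ denotes the $i$-th standard basis vector (of $\mathbb Z^{n+1}$ when added to $\mathbf m$, of $\mathbb Z^{n-1}$ when added to $\mathbf r$). Below, $\mathbf m=\mathbf m(w,\mathbf r)$, $\mathbf r,\mathbf s\in\Omega$, $1\le i,j\le n-1$ (except that the summation index in $B_w$ runs over $1,\dots,n+1$), and all entries not listed are $0$. $(A_w)_{\mathbf r,\mathbf s}$: equals $a^2_{n+1}(\mathbf m)\,b^2_1(\mathbf m+\mathbf e_{n+1})$ if $\mathbf s=\mathbf r$; $a^2_{j+1}(\mathbf m)\,b_1^2(\mathbf m+\mathbf e_{j+1})$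 if $\mathbf s=\mathbf r+\mathbf e_j$. $(C_w)_{\mathbf r,\mathbf s}$: equals $a_1^2(\mathbf m)\,b_{n+1}^2(\mathbf m+\mathbf e_1)$ if $\mathbf s=\mathbf r$; $a_1^2(\mathbf m)\,b_{j+1}^2(\mathbf m+\mathbf e_1)$ if $\mathbf s=\mathbf r-\mathbf e_j$. $(B_w)_{\mathbf r,\mathbf s}$: equals $\sum_{j=1}^{n+1}a_j^2(\mathbf m)\,b_j^2(\mathbf m+\mathbf e_j)$ if $\mathbf s=\mathbf r$, where terms for which $\mathbf m+\mathbf e_j$ is not weakly decreasing are omitted; $a_{j+1}^2(\mathbf m)\,b_{n+1}^2(\mathbf m+\mathbf e_{j+1})$ if $\mathbf s=\mathbf r+\mathbf e_j$; $a_{n+1}^2(\mathbf m)\,b_{j+1}^2(\mathbf m+\mathbf e_{n+1})$ if $\mathbf s=\mathbf r-\mathbf e_j$; $a_{j+1}^2(\mathbf m)\,b_{i+1}^2(\mathbf m+\mathbf e_{j+1})$ if $\mathbf s=\mathbf r+\mathbf e_j-\mathbf e_i$ with $i\ne j$. $(X_w)_{\mathbf r,\mathbf s}$: equals $a_1^2(\mathbf m)$ if $\mathbf s=\mathbf r$. $(Y_w)_{\mathbf r,\mathbf s}$: equals $a_{n+1}^2(\mathbf m)$ if $\mathbf s=\mathbf r$; $a_{j+1}^2(\mathbf m)$ if $\mathbf s=\mathbf r+\mathbf e_j$. $(R_w)_{\mathbf r,\mathbf s}$: equals $b_1^2(\mathbf m+\mathbf e_{n+1})$ if $\mathbf s=\mathbf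 r$. $(S_w)_{\mathbf r,\mathbf s}$: equals $b_{n+1}^2(\mathbf m+\mathbf e_{n+1})$ if $\mathbf s=\mathbf r$; $b_{j+1}^2(\mathbf m+\mathbf e_{n+1})$ if $\mathbf s=\mathbf r-\mathbf e_j$.
   Formalization: If k_n=0, the diagonal entry of S_0 at r=0 is 0/0 as written; it is taken to be 1 (its value after cancellation). For n=1, k_1=0 the undefined entry b_1^2 in R_0 and A_0 (neither occurs in M, M_1, M_2) is taken to be 0. *)

theory Defs
  imports "HOL-Analysis.Analysis" "HOL-Library.Function_Algebras"
begin

text \<open>Integer tuples are functions \<open>nat \<Rightarrow> int\<close> indexed from 1; addition and subtraction of
  tuples are pointwise (\<open>Function_Algebras\<close>). Of \<open>k\<close> only the values at \<open>1, \<dots>, n\<close> and of \<open>m\<close>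
  only those at \<open>1, \<dots>, n + 1\<close> are meaningful.\<close>

definition unit_vec :: "nat \<Rightarrow> nat \<Rightarrow> int" where
  "unit_vec i = (\<lambda>l. if l = i then 1 else 0)"

definition weakly_decreasing :: "nat \<Rightarrow> (nat \<Rightarrow> int) \<Rightarrow> bool" where
  "weakly_decreasing l v \<longleftrightarrow> (\<forall>i. 1 \<le> i \<and> i < l \<longrightarrow> v (i + 1) \<le> v i)"

definition ab_denom :: "nat \<Rightarrow> (nat \<Rightarrow> int) \<Rightarrow> nat \<Rightarrow> int" where
  "ab_denom n m i = (\<Prod>j\<in>{1..n+1} - {i}. m j - m i - int j + int i)"

definition a_sq :: "nat \<Rightarrow> (nat \<Rightarrow> int) \<Rightarrow> (nat \<Rightarrow> int) \<Rightarrow> nat \<Rightarrow> real" where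
  "a_sq n k m i =
     \<bar>real_of_int (\<Prod>j=1..n. k j - m i - int j + int i - 1) / real_of_int (ab_denom n m i)\<bar>"

definition b_sq :: "nat \<Rightarrow> (nat \<Rightarrow> int) \<Rightarrow> (nat \<Rightarrow> int) \<Rightarrow> nat \<Rightarrow> real" where
  "b_sq n k m i =
     \<bar>real_of_int (\<Prod>j=1..n. k j - m i - int j + int i) / real_of_int (ab_denom n m i)\<bar>"

text \<open>Elements of \<open>Omega\<close> are \<open>undefined\<close> outside \<open>{1..n-1}\<close>; adding or subtracting
  \<open>unit_vec j\<close> with \<open>j \<in> {1..n-1}\<close> leaves those values unchanged.\<close>

definition Omega :: "nat \<Rightarrow> (nat \<Rightarrow> int) \<Rightarrow> (nat \<Rightarrow> int) set" where
  "Omega n k = (\<Pi>\<^sub>E i\<in>{1..n-1}. {0..k i - k (i + 1)})"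

definition mtuple :: "nat \<Rightarrow> (nat \<Rightarrow> int) \<Rightarrow> nat \<Rightarrow> (nat \<Rightarrow> int) \<Rightarrow> nat \<Rightarrow> int" where
  "mtuple n k w r =
     (\<lambda>i. if i = 1 then int w + k 1
          else if i \<le> n then r (i - 1) + k i
          else - (int w + (\<Sum>j=1..n-1. r j)))"

text \<open>In the matrix entries below, the listed cases for \<open>s\<close> are mutually exclusive and each
  of them determines its indices, so at most one of the conditions in each sum below holds.\<close>

definition A_mat ::
    "nat \<Rightarrow> (nat \<Rightarrow> int) \<Rightarrow> nat \<Rightarrow> (nat \<Rightarrow> int) \<Rightarrow> (nat \<Rightarrow> int) \<Rightarrow> real" where
  "A_mat n k w r s = (let m = mtuple n k w r in
     (if s = r then a_sq n k m (n+1) * b_sq n k (m + unit_vec (n+1)) 1 else 0)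
     + (\<Sum>j=1..n-1. if s = r + unit_vec j
          then a_sq n k m (j+1) * b_sq n k (m + unit_vec (j+1)) 1 else 0))"

definition C_mat ::
    "nat \<Rightarrow> (nat \<Rightarrow> int) \<Rightarrow> nat \<Rightarrow> (nat \<Rightarrow> int) \<Rightarrow> (nat \<Rightarrow> int) \<Rightarrow> real" where
  "C_mat n k w r s = (let m = mtuple n k w r in
     (if s = r then a_sq n k m 1 * b_sq n k (m + unit_vec 1) (n+1) else 0)
     + (\<Sum>j=1..n-1. if s = r - unit_vec j
          then a_sq n k m 1 * b_sq n k (m + unit_vec 1) (j+1) else 0))"

definition B_mat ::
    "nat \<Rightarrow> (nat \<Rightarrow> int) \<Rightarrow> nat \<Rightarrow> (nat \<Rightarrow> int) \<Rightarrow> (nat \<Rightarrow> int) \<Rightarrow> real" where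
  "B_mat n k w r s = (let m = mtuple n k w r in
     (if s = r
      then (\<Sum>j | j \<in> {1..n+1} \<and> weakly_decreasing (n+1) (m + unit_vec j).
              a_sq n k m j * b_sq n k (m + unit_vec j) j)
      else 0)
     + (\<Sum>j=1..n-1. if s = r + unit_vec j
          then a_sq n k m (j+1) * b_sq n k (m + unit_vec (j+1)) (n+1) else 0)
     + (\<Sum>j=1..n-1. if s = r - unit_vec j
          then a_sq n k m (n+1) * b_sq n k (m + unit_vec (n+1)) (j+1) else 0)
     + (\<Sum>j=1..n-1. \<Sum>i\<in>{1..n-1} - {j}. if s = r + unit_vec j - unit_vec i
          then a_sq n k m (j+1) * b_sq n k (m + unit_vec (j+1)) (i+1) else 0))"

definition X_mat ::
    "nat \<Rightarrow> (nat \<Rightarrow> int) \<Rightarrow> nat \<Rightarrow> (nat \<Rightarrow> int) \<Rightarrow> (nat \<Rightarrow> int) \<Rightarrow> real" where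
  "X_mat n k w r s = (if s = r then a_sq n k (mtuple n k w r) 1 else 0)"

definition Y_mat ::
    "nat \<Rightarrow> (nat \<Rightarrow> int) \<Rightarrow> nat \<Rightarrow> (nat \<Rightarrow> int) \<Rightarrow> (nat \<Rightarrow> int) \<Rightarrow> real" where
  "Y_mat n k w r s = (let m = mtuple n k w r in
     (if s = r then a_sq n k m (n+1) else 0)
     + (\<Sum>j=1..n-1. if s = r + unit_vec j then a_sq n k m (j+1) else 0))"

definition R_mat ::
    "nat \<Rightarrow> (nat \<Rightarrow> int) \<Rightarrow> nat \<Rightarrow> (nat \<Rightarrow> int) \<Rightarrow> (nat \<Rightarrow> int) \<Rightarrow> real" where
  "R_mat n k w r s =
     (if s = r then b_sq n k (mtuple n k w r + unit_vec (n+1)) 1 else 0)"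

text \<open>If \<open>k n = 0\<close>, the diagonal entry of \<open>S\<^sub>0\<close> at \<open>r = 0\<close> is formally \<open>0 / 0\<close>. There
  \<open>m j = k j\<close> for all \<open>j \<le> n\<close>, so numerator and denominator agree factor by factor, and the
  quotient is read as 1, its value by continuity. The two lemmas after the definition show that
  this is the only diagonal entry of any \<open>S\<^sub>w\<close> where the denominator vanishes, and that the
  limit is 1.\<close>

definition S_mat ::
    "nat \<Rightarrow> (nat \<Rightarrow> int) \<Rightarrow> nat \<Rightarrow> (nat \<Rightarrow> int) \<Rightarrow> (nat \<Rightarrow> int) \<Rightarrow> real" where
  "S_mat n k w r s = (let m = mtuple n k w r in
     (if s = r then
        (if ab_denom n (m + unit_vec (n+1)) (n+1) = 0 then 1
         else b_sq n k (m + unit_vec (n+1)) (n+1))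
      else 0)
     + (\<Sum>j=1..n-1. if s = r - unit_vec j
          then b_sq n k (m + unit_vec (n+1)) (j+1) else 0))"

lemma S_diagonal_denom_eq_0_iff:
  assumes "1 \<le> n" "weakly_decreasing n k" "0 \<le> k n" "r \<in> Omega n k"
  shows "ab_denom n (mtuple n k w r + unit_vec (n+1)) (n+1) = 0 \<longleftrightarrow>
    k n = 0 \<and> w = 0 \<and> (\<forall>j\<in>{1..n-1}. r j = 0)"
proof -
  let ?m = "mtuple n k w r"
  have r0: "0 \<le> r j" if "j \<in> {1..n-1}" for j
    using assms(4) that by (auto simp: Omega_def PiE_iff)
  have kn: "k n \<le> k j" if "j \<in> {1..n}" for j
    using that
  proof (induction "n - j" arbitrary: j)
    case (Suc d)
    then have "k n \<le> k (j+1)" by (intro Suc.hyps) auto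
    moreover have "k (j+1) \<le> k j"
      using assms(2) Suc by (auto simp: weakly_decreasing_def)
    ultimately show ?case by simp
  qed auto
  have s0: "0 \<le> (\<Sum>j=1..n-1. r j)" by (intro sum_nonneg r0)
  have m_last: "?m (n+1) = - (int w + (\<Sum>j=1..n-1. r j))"
    using assms(1) by (simp add: mtuple_def)
  have m_nonneg: "0 \<le> ?m j" if "j \<in> {1..n}" for j
  proof (cases "j = 1")
    case False
    with that have "j - 1 \<in> {1..n-1}" by auto
    from r0[OF this] kn[OF that] assms(3) False that show ?thesis
      by (simp add: mtuple_def)
  qed (use kn[OF that] assms(3) in \<open>simp add: mtuple_def\<close>)
  have set_eq: "{1..n+1} - {n+1} = {1..n}" by auto
  have "ab_denom n (?m + unit_vec (n+1)) (n+1) = 0 \<longleftrightarrow>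
      (\<exists>j\<in>{1..n}. ?m j - ?m (n+1) + int n - int j = 0)"
    unfolding ab_denom_def set_eq by (auto simp: unit_vec_def algebra_simps)
  also have "\<dots> \<longleftrightarrow> ?m n = 0 \<and> ?m (n+1) = 0"
  proof
    assume "\<exists>j\<in>{1..n}. ?m j - ?m (n+1) + int n - int j = 0"
    then obtain j where j: "j \<in> {1..n}" "?m j - ?m (n+1) + int n - int j = 0" by blast
    have "int j \<le> int n" using j by simp
    moreover have "?m (n+1) \<le> 0" using m_last s0 by linarith
    ultimately have "int j = int n \<and> ?m (n+1) = 0 \<and> ?m j = 0"
      using j(2) m_nonneg[OF j(1)] by linarith
    then show "?m n = 0 \<and> ?m (n+1) = 0" by (metis of_nat_eq_iff)
  next
    assume "?m n = 0 \<and> ?m (n+1) = 0"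
    then show "\<exists>j\<in>{1..n}. ?m j - ?m (n+1) + int n - int j = 0"
      using assms(1) by (intro bexI[of _ n]) auto
  qed
  also have "\<dots> \<longleftrightarrow> ?m n = 0 \<and> w = 0 \<and> (\<forall>j\<in>{1..n-1}. r j = 0)"
  proof -
    have "?m (n+1) = 0 \<longleftrightarrow> w = 0 \<and> (\<Sum>j=1..n-1. r j) = 0"
      using m_last s0 by linarith
    also have "(\<Sum>j=1..n-1. r j) = 0 \<longleftrightarrow> (\<forall>j\<in>{1..n-1}. r j = 0)"
      by (rule sum_nonneg_eq_0_iff) (use r0 in auto)
    finally show ?thesis by simp
  qed
  also have "\<dots> \<longleftrightarrow> k n = 0 \<and> w = 0 \<and> (\<forall>j\<in>{1..n-1}. r j = 0)"
    using assms(1) by (cases "n = 1") (auto simp: mtuple_def)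
  finally show ?thesis .
qed

lemma S_diagonal_limit:
  fixes n :: nat and k r :: "nat \<Rightarrow> int" and c :: real
  assumes "\<forall>j\<in>{1..n-1}. r j = 0"
  defines "m \<equiv> mtuple n k 0 r"
  shows "((\<lambda>x::real. \<bar>(\<Prod>j=1..n. real_of_int (k j) - x - real j + real (n+1)) /
      (\<Prod>j\<in>{1..n+1} - {n+1}. real_of_int (m j) - x - real j + real (n+1))\<bar>) \<longlongrightarrow> 1) (at c)"
proof -
  have set_eq: "{1..n+1} - {n+1} = {1..n}" by auto
  have mk: "m j = k j" if "j \<in> {1..n}" for j
  proof (cases "j = 1")
    case False
    with that have "j - 1 \<in> {1..n-1}" by auto
    with assms(1) have "r (j - 1) = 0" by blast
    with False that show ?thesis by (simp add: m_def mtuple_def)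
  qed (simp add: m_def mtuple_def)
  have "\<forall>\<^sub>F x in at c. \<forall>j\<in>{1..n}. real_of_int (k j) - x - real j + real (n+1) \<noteq> 0"
  proof (intro eventually_ball_finite ballI)
    fix j
    have "\<forall>\<^sub>F x in at c. x \<noteq> real_of_int (k j) - real j + real (n+1)"
      by (rule eventually_neq_at_within)
    then show "\<forall>\<^sub>F x in at c. real_of_int (k j) - x - real j + real (n+1) \<noteq> 0"
      by eventually_elim auto
  qed simp
  then have "\<forall>\<^sub>F x in at c. \<bar>(\<Prod>j=1..n. real_of_int (k j) - x - real j + real (n+1)) /
      (\<Prod>j\<in>{1..n+1} - {n+1}. real_of_int (m j) - x - real j + real (n+1))\<bar> = 1"
  proof eventually_elim
    case (elim x)
    then have "(\<Prod>j=1..n. real_of_int (k j) - x - real j + real (n+1)) \<noteq> 0" by simp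
    then show ?case unfolding set_eq using mk by simp
  qed
  then show ?thesis by (rule tendsto_eventually)
qed

definition mat_mult :: "'i set \<Rightarrow> ('i \<Rightarrow> 'i \<Rightarrow> real) \<Rightarrow> ('i \<Rightarrow> 'i \<Rightarrow> real) \<Rightarrow> 'i \<Rightarrow> 'i \<Rightarrow> real" where
  "mat_mult I P Q r s = (\<Sum>t\<in>I. P r t * Q t s)"

text \<open>The infinite block matrices are indexed by pairs \<open>(w, r)\<close> with \<open>r \<in> Omega n k\<close>.\<close>

definition block_index :: "nat \<Rightarrow> (nat \<Rightarrow> int) \<Rightarrow> (nat \<times> (nat \<Rightarrow> int)) set" where
  "block_index n k = UNIV \<times> Omega n k"

definition M_mat ::
    "nat \<Rightarrow> (nat \<Rightarrow> int) \<Rightarrow> nat \<times> (nat \<Rightarrow> int) \<Rightarrow> nat \<times> (nat \<Rightarrow> int) \<Rightarrow> real" where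
  "M_mat n k = (\<lambda>(w, r) (v, s).
     if v = w then B_mat n k w r s
     else if v = w + 1 then C_mat n k w r s
     else if w = v + 1 then A_mat n k w r s
     else 0)"

definition M1_mat ::
    "nat \<Rightarrow> (nat \<Rightarrow> int) \<Rightarrow> nat \<times> (nat \<Rightarrow> int) \<Rightarrow> nat \<times> (nat \<Rightarrow> int) \<Rightarrow> real" where
  "M1_mat n k = (\<lambda>(w, r) (v, s).
     if v = w then Y_mat n k w r s
     else if v = w + 1 then X_mat n k w r s
     else 0)"

definition M2_mat ::
    "nat \<Rightarrow> (nat \<Rightarrow> int) \<Rightarrow> nat \<times> (nat \<Rightarrow> int) \<Rightarrow> nat \<times> (nat \<Rightarrow> int) \<Rightarrow> real" where
  "M2_mat n k = (\<lambda>(w, r) (v, s).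
     if v = w then S_mat n k w r s
     else if w = v + 1 then R_mat n k w r s
     else 0)"

text \<open>\<open>M = P Q\<close> for matrices with a possibly infinite index set: every entry of the product
  is a convergent sum with the right value.\<close>

definition is_product ::
    "'i set \<Rightarrow> ('i \<Rightarrow> 'i \<Rightarrow> real) \<Rightarrow> ('i \<Rightarrow> 'i \<Rightarrow> real) \<Rightarrow> ('i \<Rightarrow> 'i \<Rightarrow> real) \<Rightarrow> bool" where
  "is_product I M P Q \<longleftrightarrow> (\<forall>p\<in>I. \<forall>q\<in>I. ((\<lambda>t. P p t * Q t q) has_sum M p q) I)"

definition stochastic :: "'i set \<Rightarrow> ('i \<Rightarrow> 'i \<Rightarrow> real) \<Rightarrow> bool" where
  "stochastic I P \<longleftrightarrow> (\<forall>p\<in>I. (\<forall>q\<in>I. 0 \<le> P p q) \<and> (P p has_sum 1) I)"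

definition block_identities :: "nat \<Rightarrow> (nat \<Rightarrow> int) \<Rightarrow> bool" where
  "block_identities n k \<longleftrightarrow> (\<forall>w. \<forall>r\<in>Omega n k. \<forall>s\<in>Omega n k.
     A_mat n k w r s = mat_mult (Omega n k) (Y_mat n k w) (R_mat n k w) r s \<and>
     B_mat n k w r s = mat_mult (Omega n k) (X_mat n k w) (R_mat n k (w+1)) r s
                     + mat_mult (Omega n k) (Y_mat n k w) (S_mat n k w) r s \<and>
     C_mat n k w r s = mat_mult (Omega n k) (X_mat n k w) (S_mat n k (w+1)) r s)"

end

(* For the rows of M1 put x_j = m_j - j and z_j = k_j - j - 1, for those of M2 take m + e_{n+1}
   in place of m and z_j = k_j - j. Either way the z_j interlace the x_j, so the absolute values
   in the definition of a^2 and b^2 can be dropped: the row sums become the leading coefficient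
   of the Lagrange interpolation of the monic polynomial \<Prod> (t - z_j) of degree n at the
   n + 1 nodes x_i, that is, 1. Moves leaving Omega have weight 0, because there k and m
   coincide in an entry that occurs in the numerator. With this, the block identities compare
   the two half-steps of a walk r \<rightarrow> r + eps_j \<rightarrow> r + eps_j - eps_i term by term. *)

theory Submission
  imports Defs
begin

section \<open>Lagrange interpolation at interlacing nodes\<close>

text \<open>\<open>P\<close>, the product of the t - z_j, is monic of degree \<open>card J\<close>,
  and \<open>Q\<close> is its Lagrange interpolant at the nodes x_i. Both have degree less than the
  number of nodes, so they coincide, and the sum is the coefficient of t^(\<open>card J\<close>) in
  \<open>Q\<close>.\<close>

lemma sum_prod_diff_quotients_eq_1:
  fixes x :: "'a \<Rightarrow> 'c::field" and z :: "'b \<Rightarrow> 'c"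
  assumes "inj_on x I" and "card I = Suc (card J)"
  shows "(\<Sum>i\<in>I. (\<Prod>j\<in>J. x i - z j) / (\<Prod>j\<in>I - {i}. x i - x j)) = 1"
proof -
  have fin: "finite I" using assms(2) card.infinite by fastforce
  define c where "c = (\<lambda>i. (\<Prod>j\<in>J. x i - z j) / (\<Prod>j\<in>I - {i}. x i - x j))"
  define P where "P = (\<Prod>j\<in>J. [:- z j, 1:])"
  define L where "L = (\<lambda>i. \<Prod>j\<in>I - {i}. [:- x j, 1:])"
  define Q where "Q = (\<Sum>i\<in>I. smult (c i) (L i))"
  have degP: "degree P = card J"
    unfolding P_def by (subst degree_prod_eq_sum_degree) auto
  have degL: "degree (L i) = card J" if "i \<in> I" for i
    using that assms(2) fin unfolding L_def by (subst degree_prod_eq_sum_degree) auto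
  have coeffP: "coeff P (card J) = 1"
    using lead_coeff_prod[of "\<lambda>j. [:- z j, 1:]" J] degP by (simp add: P_def)
  have coeffL: "coeff (L i) (card J) = 1" if "i \<in> I" for i
    using lead_coeff_prod[of "\<lambda>j. [:- x j, 1:]" "I - {i}"] degL[OF that] by (simp add: L_def)
  have "P = Q"
  proof (rule poly_eqI_degree[of "x ` I"])
    fix t assume "t \<in> x ` I"
    then obtain i where i: "i \<in> I" "t = x i" by blast
    have "poly (L l) (x i) = 0" if "l \<in> I" "l \<noteq> i" for l
      using that i fin by (auto simp: L_def poly_prod intro!: prod_zero)
    then have "poly Q t = c i * poly (L i) (x i)"
      unfolding Q_def poly_sum i(2) using i(1) fin
      by (subst sum.remove[of _ i]) (auto intro!: sum.neutral)
    also have "poly (L i) (x i) = (\<Prod>j\<in>I - {i}. x i - x j)"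
      by (simp add: L_def poly_prod)
    also have "c i * \<dots> = (\<Prod>j\<in>J. x i - z j)"
    proof -
      have "(\<Prod>j\<in>I - {i}. x i - x j) \<noteq> 0"
        using fin i assms(1) by (auto simp: prod_zero_iff inj_on_def)
      then show ?thesis by (simp add: c_def)
    qed
    finally show "poly P t = poly Q t"
      by (simp add: P_def poly_prod i(2))
  next
    show "degree P < card (x ` I)"
      using assms by (simp add: degP card_image)
    have "degree Q \<le> card J"
      unfolding Q_def by (rule degree_sum_le[OF fin]) (use degL degree_smult_le in fastforce)
    then show "degree Q < card (x ` I)"
      using assms by (simp add: card_image)
  qed
  then have "1 = coeff Q (card J)" using coeffP by simp
  also have "\<dots> = (\<Sum>i\<in>I. c i)"
    unfolding Q_def coeff_sum by (intro sum.cong) (simp_all add: coeffL)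
  finally show ?thesis by (simp add: c_def)
qed

text \<open>Pair z_j with x_j for j < i and with x_(j+1) for j \<ge> i, so that the node x_i is
  skipped. In each pair numerator and denominator have the same weak sign; division by 0 yields
  0.\<close>

lemma interlacing_quotient_nonneg:
  fixes x z :: "nat \<Rightarrow> real"
  assumes z: "\<And>j. j \<in> {1..n} \<Longrightarrow> z j \<le> x j \<and> x (j+1) \<le> z j"
    and anti: "\<And>i j. i \<in> {1..n+1} \<Longrightarrow> j \<in> {1..n+1} \<Longrightarrow> i \<le> j \<Longrightarrow> x j \<le> x i"
    and i: "i \<in> {1..n+1}"
  shows "0 \<le> (\<Prod>j=1..n. x i - z j) / (\<Prod>j\<in>{1..n+1} - {i}. x i - x j)"
proof -
  let ?\<tau> = "\<lambda>j. if j < i then j else j + 1"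
  have "(\<Prod>j\<in>{1..n+1} - {i}. x i - x j) = (\<Prod>j=1..n. x i - x (?\<tau> j))"
    using i by (intro prod.reindex_bij_witness[of _ ?\<tau> "\<lambda>j. if j < i then j else j - 1"]) auto
  then have "(\<Prod>j=1..n. x i - z j) / (\<Prod>j\<in>{1..n+1} - {i}. x i - x j)
      = (\<Prod>j=1..n. (x i - z j) / (x i - x (?\<tau> j)))"
    by (simp add: prod_dividef)
  also have "\<dots> \<ge> 0"
  proof (rule prod_nonneg)
    fix j assume j: "j \<in> {1..n}"
    show "0 \<le> (x i - z j) / (x i - x (?\<tau> j))"
    proof (cases "j < i")
      case True
      then have "x i \<le> x (j+1)" using anti[of "j+1" i] i j by auto
      then show ?thesis using z[OF j] True by (auto intro!: divide_nonpos_nonpos)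
    next
      case False
      then have "x j \<le> x i" using anti[of i j] i j by auto
      then show ?thesis using z[OF j] False by (auto intro!: divide_nonneg_nonneg)
    qed
  qed
  finally show ?thesis .
qed

text \<open>Under the absolute value every factor may be reversed, which gives the Lagrange
  coefficients; interlacing makes these nonnegative.\<close>

lemma sum_abs_interlacing_quotients_eq_1:
  fixes x z :: "nat \<Rightarrow> real"
  assumes z: "\<And>j. j \<in> {1..n} \<Longrightarrow> z j \<le> x j \<and> x (j+1) \<le> z j"
    and strict: "\<And>j. j \<in> {1..n} \<Longrightarrow> x (j+1) < x j"
  shows "(\<Sum>i=1..n+1. \<bar>(\<Prod>j=1..n. z j - x i) / (\<Prod>j\<in>{1..n+1} - {i}. x j - x i)\<bar>) = 1"
proof -
  have less: "x j < x i" if "i \<in> {1..n+1}" "j \<in> {1..n+1}" "i < j" for i j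
    using \<open>i < j\<close> that(1,2)
  proof (induction rule: strict_inc_induct)
    case (base i) then show ?case using strict[of i] by auto
  next
    case (step i) then show ?case using strict[of i] by fastforce
  qed
  have "inj_on x {1..n+1}"
    by (rule linorder_inj_onI) (use less in force)+
  then have lagrange:
    "(\<Sum>i=1..n+1. (\<Prod>j=1..n. x i - z j) / (\<Prod>j\<in>{1..n+1} - {i}. x i - x j)) = 1"
    by (rule sum_prod_diff_quotients_eq_1) simp
  have abs_eq: "\<bar>(\<Prod>j=1..n. z j - x i) / (\<Prod>j\<in>{1..n+1} - {i}. x j - x i)\<bar>
      = (\<Prod>j=1..n. x i - z j) / (\<Prod>j\<in>{1..n+1} - {i}. x i - x j)"
    if "i \<in> {1..n+1}" for i
  proof -
    have "\<bar>(\<Prod>j=1..n. z j - x i) / (\<Prod>j\<in>{1..n+1} - {i}. x j - x i)\<bar>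
        = \<bar>(\<Prod>j=1..n. x i - z j) / (\<Prod>j\<in>{1..n+1} - {i}. x i - x j)\<bar>"
      by (simp add: abs_divide abs_prod abs_minus_commute)
    also have "\<dots> = (\<Prod>j=1..n. x i - z j) / (\<Prod>j\<in>{1..n+1} - {i}. x i - x j)"
      using interlacing_quotient_nonneg[of n z x i] z that less
      by (metis abs_of_nonneg less_eq_real_def order_le_less)
    finally show ?thesis .
  qed
  show ?thesis by (rule trans[OF sum.cong[OF refl abs_eq] lagrange])
qed

section \<open>The weights\<close>

text \<open>The -1 in z_j = k_j - j - 1 turns m_(j+1) \<le> k_j into x_(j+1) \<le> z_j and k_j \<le>
  m_j into z_j < x_j, so the nodes decrease strictly.\<close>

lemma a_sq_sum_eq_1:
  assumes "\<And>j. j \<in> {1..n} \<Longrightarrow> k j \<le> m j \<and> m (j+1) \<le> k j"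
  shows "(\<Sum>i=1..n+1. a_sq n k m i) = 1"
proof -
  have "(\<Sum>i=1..n+1. a_sq n k m i) =
    (\<Sum>i=1..n+1. \<bar>(\<Prod>j=1..n. real_of_int (k j - int j - 1) - real_of_int (m i - int i)) /
      (\<Prod>j\<in>{1..n+1} - {i}. real_of_int (m j - int j) - real_of_int (m i - int i))\<bar>)"
    unfolding a_sq_def ab_denom_def of_int_prod
    by (intro sum.cong refl arg_cong[where f = abs] arg_cong2[where f = "(/)"] prod.cong) auto
  also have "\<dots> = 1"
    by (rule sum_abs_interlacing_quotients_eq_1) (use assms in fastforce)+
  finally show ?thesis .
qed

text \<open>Now z_j = k_j - j, and x_(j+1) \<le> z_j leaves room for m_(j+1) = k_j + 1, which m +
  e_(n+1) can attain at j = n. Interlacing is only weak, so the second assumption supplies distinct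
  nodes.\<close>

lemma b_sq_sum_eq_1:
  assumes "\<And>j. j \<in> {1..n} \<Longrightarrow> k j \<le> m j \<and> m (j+1) \<le> k j + 1"
    and "\<And>j. j \<in> {1..n} \<Longrightarrow> m (j+1) \<le> m j"
  shows "(\<Sum>i=1..n+1. b_sq n k m i) = 1"
proof -
  have "(\<Sum>i=1..n+1. b_sq n k m i) =
    (\<Sum>i=1..n+1. \<bar>(\<Prod>j=1..n. real_of_int (k j - int j) - real_of_int (m i - int i)) /
      (\<Prod>j\<in>{1..n+1} - {i}. real_of_int (m j - int j) - real_of_int (m i - int i))\<bar>)"
    unfolding b_sq_def ab_denom_def of_int_prod
    by (intro sum.cong refl arg_cong[where f = abs] arg_cong2[where f = "(/)"] prod.cong) auto
  also have "\<dots> = 1"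
    by (rule sum_abs_interlacing_quotients_eq_1) (use assms in fastforce)+
  finally show ?thesis .
qed

text \<open>The factor j = i of the numerator is k_i - m_(i+1).\<close>

lemma a_sq_Suc_eq_0: "i \<in> {1..n} \<Longrightarrow> k i = m (i+1) \<Longrightarrow> a_sq n k m (i+1) = 0"
  unfolding a_sq_def by (auto intro!: bexI[of _ i])

lemma b_sq_eq_0: "i \<in> {1..n} \<Longrightarrow> k i = m i \<Longrightarrow> b_sq n k m i = 0"
  unfolding b_sq_def by (auto intro!: bexI[of _ i])

lemma b_sq_cong:
  assumes "i \<in> {1..n+1}" and "\<And>j. j \<in> {1..n+1} \<Longrightarrow> m j = m' j"
  shows "b_sq n k m i = b_sq n k m' i"
proof -
  have "m i = m' i" using assms by simp
  moreover have "ab_denom n m i = ab_denom n m' i"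
    unfolding ab_denom_def using assms by (intro prod.cong) auto
  ultimately show ?thesis by (simp add: b_sq_def)
qed

lemma a_sq_nonneg: "0 \<le> a_sq n k m i" and b_sq_nonneg: "0 \<le> b_sq n k m i"
  by (simp_all add: a_sq_def b_sq_def)

section \<open>The matrices as sums over moves\<close>

text \<open>The change of \<open>r\<close> when \<open>m\<close> gains a unit in entry \<open>i \<in> {2..n+1}\<close> and, to keep the sum of
  its entries, loses one in the entry \<open>n + 1\<close>.\<close>

definition move :: "nat \<Rightarrow> nat \<Rightarrow> nat \<Rightarrow> int" where
  "move n i = (if i = n + 1 then 0 else unit_vec (i - 1))"

text \<open>The entry of \<open>S\<close> for the move \<open>i\<close>, with the convention \<open>0 / 0 = 1\<close> of \<open>S_mat\<close>.\<close>

definition s_weight :: "nat \<Rightarrow> (nat \<Rightarrow> int) \<Rightarrow> nat \<Rightarrow> (nat \<Rightarrow> int) \<Rightarrow> nat \<Rightarrow> real" where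
  "s_weight n k w r i = (let m = mtuple n k w r + unit_vec (n+1) in
     if i = n + 1 \<and> ab_denom n m (n+1) = 0 then 1 else b_sq n k m i)"

text \<open>Separates the move n + 1, which fixes r, as the matrix definitions do.\<close>

lemma sum_moves:
  fixes f :: "nat \<Rightarrow> 'a::comm_monoid_add"
  assumes "1 \<le> n"
  shows "(\<Sum>j=2..n+1. f j) = f (n+1) + (\<Sum>j=1..n-1. f (j+1))"
proof -
  obtain p where "n = Suc p" using assms by (cases n) auto
  then show ?thesis
    using sum.shift_bounds_cl_Suc_ivl[of f 1 "p"]
    by (simp add: numeral_2_eq_2 add.commute)
qed

lemma Y_mat_eq_sum_moves:
  assumes "1 \<le> n"
  shows "Y_mat n k w r s =
    (\<Sum>j=2..n+1. if s = r + move n j then a_sq n k (mtuple n k w r) j else 0)"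
  unfolding sum_moves[OF assms] Y_mat_def Let_def move_def
  by (intro arg_cong2[where f = "(+)"] sum.cong) auto

lemma S_mat_eq_sum_moves:
  assumes "1 \<le> n"
  shows "S_mat n k w r s = (\<Sum>i=2..n+1. if s = r - move n i then s_weight n k w r i else 0)"
  unfolding sum_moves[OF assms] S_mat_def s_weight_def Let_def move_def
  by (intro arg_cong2[where f = "(+)"] sum.cong) auto

lemma A_mat_eq_sum_moves:
  assumes "1 \<le> n"
  shows "A_mat n k w r s = (\<Sum>j=2..n+1. if s = r + move n j
    then a_sq n k (mtuple n k w r) j * b_sq n k (mtuple n k w r + unit_vec j) 1 else 0)"
  unfolding sum_moves[OF assms] A_mat_def Let_def move_def
  by (intro arg_cong2[where f = "(+)"] sum.cong) auto

lemma C_mat_eq_sum_moves: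
  assumes "1 \<le> n"
  shows "C_mat n k w r s = (\<Sum>i=2..n+1. if s = r - move n i
    then a_sq n k (mtuple n k w r) 1 * b_sq n k (mtuple n k w r + unit_vec 1) i else 0)"
  unfolding sum_moves[OF assms] C_mat_def Let_def move_def
  by (intro arg_cong2[where f = "(+)"] sum.cong) auto

text \<open>A move j \<le> n raises m_j and lowers m_(n+1), which e_(n+1) restores. Past n + 1,
  \<open>mtuple\<close> repeats its last entry, hence the restriction on l.\<close>

lemma mtuple_add_move:
  assumes "j \<in> {2..n+1}" and "l \<in> {1..n+1}"
  shows "(mtuple n k w (r + move n j) + unit_vec (n+1)) l = (mtuple n k w r + unit_vec j) l"
proof (cases "j = n + 1")
  case True
  then show ?thesis by (simp add: move_def)
next
  case False
  with assms have j: "j - 1 \<in> {1..n-1}" by auto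
  then have "(\<Sum>i=1..n-1. unit_vec (j - 1) i) = 1"
    unfolding unit_vec_def by (subst sum.delta) auto
  with False assms j show ?thesis
    by (auto simp: mtuple_def move_def unit_vec_def sum.distrib)
qed

lemma mtuple_Suc:
  assumes "1 \<le> n" and "l \<in> {1..n+1}"
  shows "(mtuple n k (w+1) r + unit_vec (n+1)) l = (mtuple n k w r + unit_vec 1) l"
  using assms by (auto simp: mtuple_def unit_vec_def)

lemma b_sq_move:
  assumes "j \<in> {2..n+1}" and "i \<in> {1..n+1}"
  shows "b_sq n k (mtuple n k w (r + move n j) + unit_vec (n+1)) i
    = b_sq n k (mtuple n k w r + unit_vec j) i"
  using mtuple_add_move[OF assms(1)] by (intro b_sq_cong assms(2))

lemma b_sq_mtuple_Suc:
  assumes "1 \<le> n" and "i \<in> {1..n+1}"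
  shows "b_sq n k (mtuple n k (w+1) r + unit_vec (n+1)) i
    = b_sq n k (mtuple n k w r + unit_vec 1) i"
  using mtuple_Suc[OF assms(1)] by (intro b_sq_cong assms(2))

section \<open>The boundary of Omega\<close>

lemma finite_Omega: "finite (Omega n k)"
  unfolding Omega_def by (intro finite_PiE) auto

lemma Omega_nonneg: "r \<in> Omega n k \<Longrightarrow> i \<in> {1..n-1} \<Longrightarrow> 0 \<le> r i"
  by (auto simp: Omega_def)

lemma Omega_le: "r \<in> Omega n k \<Longrightarrow> i \<in> {1..n-1} \<Longrightarrow> r i \<le> k i - k (i+1)"
  by (auto simp: Omega_def PiE_iff)

lemma Omega_add_unit_vec_iff:
  assumes "r \<in> Omega n k" and "i \<in> {1..n-1}"
  shows "r + unit_vec i \<in> Omega n k \<longleftrightarrow> r i < k i - k (i+1)"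
  using assms by (auto simp: Omega_def PiE_iff unit_vec_def extensional_def)

lemma Omega_diff_unit_vec_iff:
  assumes "r \<in> Omega n k" and "i \<in> {1..n-1}"
  shows "r - unit_vec i \<in> Omega n k \<longleftrightarrow> 0 < r i"
proof -
  have "r i - 1 \<le> k i - k (i+1)" using Omega_le[OF assms] by simp
  with assms show ?thesis by (auto simp: Omega_def PiE_iff unit_vec_def extensional_def)
qed

text \<open>Leaving Omega by the move i + 1 means r_i = k_i - k_(i+1), that is, m_(i+1) =
  k_i.\<close>

lemma a_sq_eq_0_outside:
  assumes "r \<in> Omega n k" and "j \<in> {2..n+1}" and "r + move n j \<notin> Omega n k"
  shows "a_sq n k (mtuple n k w r) j = 0"
proof -
  obtain i where i: "j = i + 1" "i \<in> {1..n}" using assms(2) by (cases j) auto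
  with assms(1,3) have "i \<in> {1..n-1}" by (cases "i = n") (auto simp: move_def)
  with i assms show ?thesis
    using Omega_add_unit_vec_iff[OF assms(1), of i] Omega_le[OF assms(1), of i]
    unfolding i(1) by (intro a_sq_Suc_eq_0) (auto simp: move_def mtuple_def)
qed

text \<open>Targets outside Omega carry weight 0, so the values of f there do not matter.\<close>

lemma sum_Y_mat:
  assumes "1 \<le> n" and "r \<in> Omega n k"
  shows "(\<Sum>t\<in>Omega n k. Y_mat n k w r t * f t)
    = (\<Sum>j=2..n+1. a_sq n k (mtuple n k w r) j * f (r + move n j))"
proof -
  let ?a = "a_sq n k (mtuple n k w r)"
  have "(\<Sum>t\<in>Omega n k. Y_mat n k w r t * f t)
      = (\<Sum>j=2..n+1. \<Sum>t\<in>Omega n k. if t = r + move n j then ?a j * f t else 0)"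
    unfolding Y_mat_eq_sum_moves[OF assms(1)] sum_distrib_right
    by (subst sum.swap) (intro sum.cong, auto)
  also have "\<dots> = (\<Sum>j=2..n+1. ?a j * f (r + move n j))"
    using a_sq_eq_0_outside[OF assms(2)]
    by (intro sum.cong) (auto simp: sum.delta[OF finite_Omega])
  finally show ?thesis .
qed

lemma sum_X_mat:
  assumes "r \<in> Omega n k"
  shows "(\<Sum>t\<in>Omega n k. X_mat n k w r t * f t) = a_sq n k (mtuple n k w r) 1 * f r"
  using assms by (simp add: X_mat_def if_distrib[of "\<lambda>u. u * _"] finite_Omega cong: if_cong)

lemma Y_mat_nonneg: "1 \<le> n \<Longrightarrow> 0 \<le> Y_mat n k w r s"
  unfolding Y_mat_eq_sum_moves by (rule sum_nonneg) (simp add: a_sq_nonneg)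

lemma s_weight_nonneg: "0 \<le> s_weight n k w r i"
  by (simp add: s_weight_def Let_def b_sq_nonneg)

lemma S_mat_nonneg: "1 \<le> n \<Longrightarrow> 0 \<le> S_mat n k w r s"
  unfolding S_mat_eq_sum_moves by (rule sum_nonneg) (simp add: s_weight_nonneg)

section \<open>Interlacing of \<open>m\<close> and \<open>k\<close>\<close>

context
  fixes n :: nat and k :: "nat \<Rightarrow> int"
  assumes n: "1 \<le> n" and wd: "weakly_decreasing n k" and kn: "0 \<le> k n"
begin

text \<open>These are the bounds 0 \<le> r_(j-1) and r_j \<le> k_j - k_(j+1), with 0 \<le> w at j =
  1 on the left. On the right j = n uses m_(n+1) \<le> 0 \<le> k_n.\<close>

lemma mtuple_interlacing:
  assumes r: "r \<in> Omega n k" and j: "j \<in> {1..n}"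
  shows "k j \<le> mtuple n k w r j \<and> mtuple n k w r (j+1) \<le> k j"
proof
  show "k j \<le> mtuple n k w r j"
  proof (cases "j = 1")
    case False
    with j have "j - 1 \<in> {1..n-1}" by auto
    from Omega_nonneg[OF r this] False j show ?thesis by (simp add: mtuple_def)
  qed (simp add: mtuple_def)
  show "mtuple n k w r (j+1) \<le> k j"
  proof (cases "j = n")
    case True
    have "0 \<le> (\<Sum>i=1..n-1. r i)" by (intro sum_nonneg Omega_nonneg[OF r])
    with True n kn show ?thesis by (simp add: mtuple_def)
  next
    case False
    with j have "j \<in> {1..n-1}" by auto
    from Omega_le[OF r this] False j show ?thesis by (simp add: mtuple_def)
  qed
qed

lemma denom_eq_0_iff:
  assumes "r \<in> Omega n k"
  shows "ab_denom n (mtuple n k w r + unit_vec (n+1)) (n+1) = 0 \<longleftrightarrow>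
    k n = 0 \<and> w = 0 \<and> (\<forall>j\<in>{1..n-1}. r j = 0)"
  using n wd kn assms by (rule S_diagonal_denom_eq_0_iff)

text \<open>Since m_(i+1) \<le> k_i \<le> m_i, order at i breaks only by raising m_(i+1) = k_i. So
  the terms omitted on the diagonal of B are 0 in any case.\<close>

lemma a_sq_eq_0_not_decreasing:
  assumes r: "r \<in> Omega n k" and j: "j \<in> {1..n+1}"
    and "\<not> weakly_decreasing (n+1) (mtuple n k w r + unit_vec j)"
  shows "a_sq n k (mtuple n k w r) j = 0"
proof -
  let ?m = "mtuple n k w r"
  obtain i where i: "i \<in> {1..n}" "(?m + unit_vec j) i < (?m + unit_vec j) (i+1)"
    using assms(3) by (auto simp: weakly_decreasing_def not_le less_Suc_eq_le)
  with mtuple_interlacing[OF r i(1), of w] have "j = i + 1" "k i = ?m (i+1)"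
    by (auto simp: unit_vec_def split: if_splits)
  with i(1) show ?thesis using a_sq_Suc_eq_0 by blast
qed

section \<open>Row sums of the weights\<close>

lemma Y_row_sum:
  assumes r: "r \<in> Omega n k"
  shows "a_sq n k (mtuple n k w r) 1 + (\<Sum>t\<in>Omega n k. Y_mat n k w r t) = 1"
proof -
  have "{1..n+1} = insert 1 {2..n+1}" by auto
  then have "a_sq n k (mtuple n k w r) 1 + (\<Sum>j=2..n+1. a_sq n k (mtuple n k w r) j)
      = (\<Sum>j=1..n+1. a_sq n k (mtuple n k w r) j)" by simp
  also have "\<dots> = 1" by (rule a_sq_sum_eq_1) (rule mtuple_interlacing[OF r])
  finally show ?thesis using sum_Y_mat[OF n r, of w "\<lambda>_. 1"] by simp
qed

text \<open>Leaving Omega means r_(i-1) = 0, so m_i = k_i and the factor k_i - m_i vanishes. The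
  convention for 0 / 0 concerns only the move n + 1, which stays in Omega.\<close>

lemma s_weight_eq_0_outside:
  assumes r: "r \<in> Omega n k" and "i \<in> {2..n+1}" and "r - move n i \<notin> Omega n k"
  shows "s_weight n k w r i = 0"
proof -
  from assms have i: "i \<in> {2..n}" by (cases "i = n + 1") (auto simp: move_def)
  then have "i - 1 \<in> {1..n-1}" by auto
  with Omega_diff_unit_vec_iff[OF r this] Omega_nonneg[OF r this] assms(3) i
  have "r (i - 1) = 0" by (auto simp: move_def)
  with i show ?thesis
    by (auto simp: s_weight_def mtuple_def unit_vec_def intro!: b_sq_eq_0)
qed

text \<open>In the degenerate row m_i = k_i for all i \<le> n, so the value 1 assigned to 0 / 0 is
  the only nonzero weight. In every other row m + e_(n+1) is still weakly decreasing and
  interpolation applies.\<close>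

lemma s_weight_sum_eq_1:
  assumes r: "r \<in> Omega n k"
  shows "b_sq n k (mtuple n k w r + unit_vec (n+1)) 1 + (\<Sum>i=2..n+1. s_weight n k w r i) = 1"
proof -
  let ?m = "mtuple n k w r + unit_vec (n+1)"
  have ins: "{1..n+1} = insert 1 {2..n+1}" by auto
  show ?thesis
  proof (cases "ab_denom n ?m (n+1) = 0")
    case True
    then have "w = 0" and r0: "\<forall>j\<in>{1..n-1}. r j = 0"
      using denom_eq_0_iff[OF r, of w] by auto
    have mk: "?m i = k i" if "i \<in> {1..n}" for i
    proof (cases "i = 1")
      case False
      with that have "i - 1 \<in> {1..n-1}" by auto
      with r0 have "r (i - 1) = 0" by blast
      with that False show ?thesis by (simp add: mtuple_def unit_vec_def)
    qed (use n \<open>w = 0\<close> in \<open>simp add: mtuple_def unit_vec_def\<close>)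
    have b0: "b_sq n k ?m i = 0" if "i \<in> {1..n}" for i
      using that mk by (intro b_sq_eq_0) simp_all
    have "(\<Sum>i=2..n+1. s_weight n k w r i) = s_weight n k w r (n+1)"
      unfolding sum_moves[OF n] using b0 by (auto simp: s_weight_def Let_def intro!: sum.neutral)
    with True b0[of 1] n show ?thesis by (simp add: s_weight_def)
  next
    case False
    \<comment> \<open>The factor j = n of the denominator is \<open>?m n - ?m (n+1) + 1\<close>;
      position n is the only place where adding e_(n+1) can break the order.\<close>
    have ne: "?m (n+1) \<noteq> ?m n + 1"
    proof
      assume "?m (n+1) = ?m n + 1"
      with n have "ab_denom n ?m (n+1) = 0"
        unfolding ab_denom_def by (intro prod_zero bexI[of _ n]) (auto simp del: plus_fun_apply)
      with False show False by simp
    qed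
    have inter: "k j \<le> ?m j \<and> ?m (j+1) \<le> k j + 1" if "j \<in> {1..n}" for j
      using mtuple_interlacing[OF r that, of w] that by (auto simp: unit_vec_def)
    have decr: "?m (j+1) \<le> ?m j" if "j \<in> {1..n}" for j
      using mtuple_interlacing[OF r that, of w] that ne by (auto simp: unit_vec_def)
    have "(\<Sum>i=2..n+1. s_weight n k w r i) = (\<Sum>i=2..n+1. b_sq n k ?m i)"
      using False by (intro sum.cong) (auto simp: s_weight_def)
    moreover have "(\<Sum>i=1..n+1. b_sq n k ?m i) = 1"
      using inter decr by (rule b_sq_sum_eq_1)
    ultimately show ?thesis unfolding ins by simp
  qed
qed

lemma S_row_sum:
  assumes r: "r \<in> Omega n k"
  shows "(\<Sum>s\<in>Omega n k. S_mat n k w r s) = (\<Sum>i=2..n+1. s_weight n k w r i)"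
  unfolding S_mat_eq_sum_moves[OF n]
  using s_weight_eq_0_outside[OF r]
  by (subst sum.swap, intro sum.cong) (auto simp: sum.delta[OF finite_Omega])

lemma R_row_sum:
  assumes "r \<in> Omega n k"
  shows "(\<Sum>s\<in>Omega n k. R_mat n k w r s) = b_sq n k (mtuple n k w r + unit_vec (n+1)) 1"
  using assms by (simp add: R_mat_def finite_Omega)

text \<open>The block \<open>R\<^sub>0\<close> lies outside \<open>M\<^sub>2\<close>; the row sums of its first block row are still 1
  because \<open>R\<^sub>0 = 0\<close>.\<close>

lemma b_sq_mtuple_0: "b_sq n k (mtuple n k 0 r + unit_vec (n+1)) 1 = 0"
  using n by (intro b_sq_eq_0) (auto simp: mtuple_def unit_vec_def)

text \<open>The convention for 0 / 0 cannot affect the product. The exceptional row is w = 0, t = 0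
  with k_n = 0; from r in Omega it is reached only by the move n + 1, as any other would need a
  negative entry of r. There m_(n+1) = 0 = k_n, so the first factor vanishes. It also vanishes when
  the move leaves Omega.\<close>

lemma a_sq_times_s_weight:
  assumes r: "r \<in> Omega n k" and j: "j \<in> {2..n+1}" and i: "i \<in> {2..n+1}"
  shows "a_sq n k (mtuple n k w r) j * s_weight n k w (r + move n j) i
    = a_sq n k (mtuple n k w r) j * b_sq n k (mtuple n k w r + unit_vec j) i"
proof (cases "r + move n j \<in> Omega n k \<and>
    ab_denom n (mtuple n k w (r + move n j) + unit_vec (n+1)) (n+1) = 0")
  case True
  with denom_eq_0_iff[of "r + move n j" w]
  have "k n = 0" "w = 0" and t0: "\<And>l. l \<in> {1..n-1} \<Longrightarrow> (r + move n j) l = 0" by auto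
  have "j = n + 1"
  proof (rule ccontr)
    assume "j \<noteq> n + 1"
    with j have "j - 1 \<in> {1..n-1}" by auto
    with t0[OF this] Omega_nonneg[OF r this] \<open>j \<noteq> n + 1\<close> show False
      by (simp add: move_def unit_vec_def)
  qed
  moreover have "k n = mtuple n k w r (n+1)"
    using t0 \<open>w = 0\<close> \<open>k n = 0\<close> n \<open>j = n + 1\<close> by (simp add: move_def mtuple_def)
  ultimately have "a_sq n k (mtuple n k w r) j = 0"
    using n a_sq_Suc_eq_0[of n n k "mtuple n k w r"] by simp
  then show ?thesis by simp
next
  case False
  then consider "a_sq n k (mtuple n k w r) j = 0"
    | "s_weight n k w (r + move n j) i = b_sq n k (mtuple n k w (r + move n j) + unit_vec (n+1)) i"
    using a_sq_eq_0_outside[OF r j] by (auto simp: s_weight_def Let_def)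
  then show ?thesis using b_sq_move[OF j, of i] i by cases auto
qed

section \<open>The block identities\<close>

lemma A_mat_eq:
  assumes r: "r \<in> Omega n k"
  shows "A_mat n k w r s = mat_mult (Omega n k) (Y_mat n k w) (R_mat n k w) r s"
  unfolding A_mat_eq_sum_moves[OF n] mat_mult_def sum_Y_mat[OF n r]
  using b_sq_move[of _ n 1] by (intro sum.cong) (auto simp: R_mat_def)

lemma C_mat_eq:
  assumes r: "r \<in> Omega n k"
  shows "C_mat n k w r s = mat_mult (Omega n k) (X_mat n k w) (S_mat n k (w+1)) r s"
proof -
  \<comment> \<open>At the positive level w + 1 the denominator is nonzero, so the convention does
    not intervene.\<close>
  have "s_weight n k (w+1) r i = b_sq n k (mtuple n k w r + unit_vec 1) i" if "i \<in> {2..n+1}" for i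
    using denom_eq_0_iff[OF r, of "w+1"] b_sq_mtuple_Suc[OF n, of i k w r] that
    by (auto simp: s_weight_def Let_def)
  then show ?thesis
    unfolding C_mat_eq_sum_moves[OF n] mat_mult_def sum_X_mat[OF r]
    unfolding S_mat_eq_sum_moves[OF n] sum_distrib_left
    by (intro sum.cong) auto
qed

text \<open>The double sum splits according to whether j and i equal n + 1. Its terms i = j all
  return to r; with the term of entry 1 they form the diagonal entry of B.\<close>

lemma B_mat_eq_sum_moves:
  fixes w :: nat
  assumes r: "r \<in> Omega n k"
  defines "m \<equiv> mtuple n k w r"
  shows "B_mat n k w r s = (if s = r then a_sq n k m 1 * b_sq n k (m + unit_vec 1) 1 else 0)
    + (\<Sum>j=2..n+1. \<Sum>i=2..n+1. if s = r + move n j - move n i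
        then a_sq n k m j * b_sq n k (m + unit_vec j) i else 0)"
proof -
  define g where "g j i = a_sq n k m j * b_sq n k (m + unit_vec j) i" for j i
  define h where "h j i = (if s = r + move n j - move n i then g j i else 0)" for j i
  have ins: "{1..n+1} = insert 1 {2..n+1}" by auto
  have "(\<Sum>j | j \<in> {1..n+1} \<and> weakly_decreasing (n+1) (m + unit_vec j). g j j)
      = (\<Sum>j=1..n+1. g j j)"
    using a_sq_eq_0_not_decreasing[OF r]
    by (intro sum.mono_neutral_left) (auto simp: g_def m_def)
  also have "\<dots> = g 1 1 + (g (n+1) (n+1) + (\<Sum>j=1..n-1. g (j+1) (j+1)))"
    unfolding sum_moves[OF n, of "\<lambda>j. g j j", symmetric] ins by simp
  finally have diag: "(\<Sum>j | j \<in> {1..n+1} \<and> weakly_decreasing (n+1) (m + unit_vec j). g j j)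
      = g 1 1 + (g (n+1) (n+1) + (\<Sum>j=1..n-1. g (j+1) (j+1)))" .
  have move: "move n (j+1) = unit_vec j" if "j \<in> {1..n-1}" for j
    using that by (auto simp: move_def)
  have inner: "(\<Sum>i=1..n-1. h (j+1) (i+1)) = (if s = r then g (j+1) (j+1) else 0)
      + (\<Sum>i\<in>{1..n-1} - {j}. if s = r + unit_vec j - unit_vec i then g (j+1) (i+1) else 0)"
    if "j \<in> {1..n-1}" for j
    unfolding sum.remove[OF finite_atLeastAtMost that]
    using that move by (intro arg_cong2[where f = "(+)"] sum.cong) (auto simp: h_def)
  have "(\<Sum>j=2..n+1. \<Sum>i=2..n+1. h j i)
      = h (n+1) (n+1) + (\<Sum>i=1..n-1. h (n+1) (i+1))
        + ((\<Sum>j=1..n-1. h (j+1) (n+1)) + (\<Sum>j=1..n-1. \<Sum>i=1..n-1. h (j+1) (i+1)))"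
    unfolding sum_moves[OF n] sum.distrib by (simp only: ac_simps)
  also have "(\<Sum>j=1..n-1. \<Sum>i=1..n-1. h (j+1) (i+1))
      = (if s = r then (\<Sum>j=1..n-1. g (j+1) (j+1)) else 0)
        + (\<Sum>j=1..n-1. \<Sum>i\<in>{1..n-1} - {j}.
            if s = r + unit_vec j - unit_vec i then g (j+1) (i+1) else 0)"
    by (subst sum.cong[OF refl inner]) (simp_all add: sum.distrib)
  also have "h (n+1) (n+1) = (if s = r then g (n+1) (n+1) else 0)"
    by (simp add: h_def)
  also have "(\<Sum>i=1..n-1. h (n+1) (i+1))
      = (\<Sum>i=1..n-1. if s = r - unit_vec i then g (n+1) (i+1) else 0)"
    using move by (intro sum.cong) (auto simp: h_def move_def)
  also have "(\<Sum>j=1..n-1. h (j+1) (n+1))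
      = (\<Sum>j=1..n-1. if s = r + unit_vec j then g (j+1) (n+1) else 0)"
    using move by (intro sum.cong) (auto simp: h_def move_def)
  finally have moves: "(\<Sum>j=2..n+1. \<Sum>i=2..n+1. h j i) =
    (if s = r then g (n+1) (n+1) else 0)
    + (\<Sum>i=1..n-1. if s = r - unit_vec i then g (n+1) (i+1) else 0)
    + ((\<Sum>j=1..n-1. if s = r + unit_vec j then g (j+1) (n+1) else 0)
      + ((if s = r then (\<Sum>j=1..n-1. g (j+1) (j+1)) else 0)
        + (\<Sum>j=1..n-1. \<Sum>i\<in>{1..n-1} - {j}.
            if s = r + unit_vec j - unit_vec i then g (j+1) (i+1) else 0)))" .
  have regroup: "(if c then p + (q + u) else 0) + x + y + z
      = (if c then p else 0) + ((if c then q else 0) + y + (x + ((if c then u else 0) + z)))"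
    for c and p q u x y z :: real by simp
  show ?thesis
    unfolding B_mat_def Let_def m_def[symmetric] g_def[symmetric] h_def[symmetric] diag moves
    by (rule regroup)
qed

text \<open>Raising and lowering m_1 passes through level w + 1, hence through X and R; all other
  pairs of moves stay at level w and pass through Y and S.\<close>

lemma B_mat_eq:
  assumes r: "r \<in> Omega n k"
  shows "B_mat n k w r s = mat_mult (Omega n k) (X_mat n k w) (R_mat n k (w+1)) r s
    + mat_mult (Omega n k) (Y_mat n k w) (S_mat n k w) r s"
proof -
  let ?m = "mtuple n k w r"
  have "mat_mult (Omega n k) (X_mat n k w) (R_mat n k (w+1)) r s
      = (if s = r then a_sq n k ?m 1 * b_sq n k (?m + unit_vec 1) 1 else 0)"
    unfolding mat_mult_def sum_X_mat[OF r] R_mat_def using b_sq_mtuple_Suc[OF n, of 1 k w r] by simp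
  moreover have "mat_mult (Omega n k) (Y_mat n k w) (S_mat n k w) r s
      = (\<Sum>j=2..n+1. \<Sum>i=2..n+1. if s = r + move n j - move n i
          then a_sq n k ?m j * b_sq n k (?m + unit_vec j) i else 0)"
    unfolding mat_mult_def sum_Y_mat[OF n r]
    unfolding S_mat_eq_sum_moves[OF n] sum_distrib_left
    using a_sq_times_s_weight[OF r] by (intro sum.cong) auto
  ultimately show ?thesis unfolding B_mat_eq_sum_moves[OF r] by simp
qed

lemma block_identities_hold: "block_identities n k"
  unfolding block_identities_def using A_mat_eq B_mat_eq C_mat_eq by blast

section \<open>The infinite matrices\<close>

text \<open>The row is supported on the levels w and w + 1, so the sum is finite. A column of
  \<open>M2_mat\<close> as f gives the product, f = 1 the row sum.\<close>

lemma has_sum_M1_mat: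
  assumes r: "r \<in> Omega n k"
  shows "((\<lambda>t. M1_mat n k (w, r) t * f t) has_sum
    (\<Sum>t\<in>Omega n k. Y_mat n k w r t * f (w, t)) + (\<Sum>t\<in>Omega n k. X_mat n k w r t * f (w+1, t)))
    (block_index n k)"
proof (rule has_sum_finite_neutralI[of "{w, w+1} \<times> Omega n k"])
  show "(\<Sum>t\<in>Omega n k. Y_mat n k w r t * f (w, t)) + (\<Sum>t\<in>Omega n k. X_mat n k w r t * f (w+1, t))
      = (\<Sum>t\<in>{w, w+1} \<times> Omega n k. M1_mat n k (w, r) t * f t)"
    by (simp add: sum.cartesian_product' M1_mat_def)
qed (auto simp: finite_Omega block_index_def M1_mat_def split: if_splits)

lemma M_mat_is_product: "is_product (block_index n k) (M_mat n k) (M1_mat n k) (M2_mat n k)"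
  unfolding is_product_def
proof (intro ballI)
  fix p q assume "p \<in> block_index n k" "q \<in> block_index n k"
  then obtain w r v s where p: "p = (w, r)" "q = (v, s)" and r: "r \<in> Omega n k"
    by (auto simp: block_index_def)
  \<comment> \<open>Column level v of \<open>M2_mat\<close> meets only the row levels v and v + 1: v
    = w - 1 leaves Y R, v = w leaves Y S and X R, v = w + 1 leaves X S.\<close>
  have "M_mat n k p q = (\<Sum>t\<in>Omega n k. Y_mat n k w r t * M2_mat n k (w, t) q)
      + (\<Sum>t\<in>Omega n k. X_mat n k w r t * M2_mat n k (w+1, t) q)"
    using A_mat_eq[OF r, of w s] B_mat_eq[OF r, of w s] C_mat_eq[OF r, of w s]
    by (auto simp: p M_mat_def M2_mat_def mat_mult_def)
  then show "((\<lambda>t. M1_mat n k p t * M2_mat n k t q) has_sum M_mat n k p q) (block_index n k)"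
    using has_sum_M1_mat[OF r, of w "\<lambda>t. M2_mat n k t q"] by (simp add: p(1))
qed

lemma M1_mat_stochastic: "stochastic (block_index n k) (M1_mat n k)"
  unfolding stochastic_def
proof (intro ballI conjI)
  fix p q show "0 \<le> M1_mat n k p q"
    by (cases p; cases q) (auto simp: M1_mat_def X_mat_def Y_mat_nonneg[OF n] a_sq_nonneg)
next
  fix p assume "p \<in> block_index n k"
  then obtain w r where p: "p = (w, r)" and r: "r \<in> Omega n k" by (auto simp: block_index_def)
  show "(M1_mat n k p has_sum 1) (block_index n k)"
    using has_sum_M1_mat[OF r, of w "\<lambda>_. 1"] Y_row_sum[OF r, of w] sum_X_mat[OF r, of w "\<lambda>_. 1"]
    by (simp add: p add.commute)
qed

lemma M2_mat_stochastic: "stochastic (block_index n k) (M2_mat n k)"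
  unfolding stochastic_def
proof (intro ballI conjI)
  fix p q show "0 \<le> M2_mat n k p q"
    by (cases p; cases q) (auto simp: M2_mat_def R_mat_def S_mat_nonneg[OF n] b_sq_nonneg)
next
  fix p assume "p \<in> block_index n k"
  then obtain w r where p: "p = (w, r)" and r: "r \<in> Omega n k" by (auto simp: block_index_def)
  show "(M2_mat n k p has_sum 1) (block_index n k)"
  \<comment> \<open>Subtraction truncates: for w = 0 only the level 0 remains, and the term of R
    that is then missing is 0.\<close>
  proof (rule has_sum_finite_neutralI[of "{w - 1, w} \<times> Omega n k"])
    have "(\<Sum>t\<in>{w - 1, w} \<times> Omega n k. M2_mat n k p t)
        = b_sq n k (mtuple n k w r + unit_vec (n+1)) 1 + (\<Sum>s\<in>Omega n k. S_mat n k w r s)"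
    proof (cases w)
      case 0
      then show ?thesis
        using b_sq_mtuple_0[of r] by (simp add: p sum.cartesian_product' M2_mat_def)
    next
      case (Suc v)
      then show ?thesis
        using R_row_sum[OF r, of w] by (simp add: p sum.cartesian_product' M2_mat_def)
    qed
    then show "1 = (\<Sum>t\<in>{w - 1, w} \<times> Omega n k. M2_mat n k p t)"
      using S_row_sum[OF r, of w] s_weight_sum_eq_1[OF r, of w] by simp
  qed (auto simp: finite_Omega block_index_def M2_mat_def p split: if_splits)
qed

end

theorem mainTheorem3:
  fixes n :: nat and k :: "nat \<Rightarrow> int"
  assumes "1 \<le> n"
    and "weakly_decreasing n k"
    and "0 \<le> k n"
  shows "block_identities n k
    \<and> (block_identities n k \<longleftrightarrow>
         is_product (block_index n k) (M_mat n k) (M1_mat n k) (M2_mat n k))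
    \<and> is_product (block_index n k) (M_mat n k) (M1_mat n k) (M2_mat n k)
    \<and> stochastic (block_index n k) (M1_mat n k)
    \<and> stochastic (block_index n k) (M2_mat n k)"
  using block_identities_hold[OF assms] M_mat_is_product[OF assms]
    M1_mat_stochastic[OF assms] M2_mat_stochastic[OF assms]
  by blast

end
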